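(* Let $b_{1,n}$ be the total number of vertices of rank $1$ in all labeled plane 1-2 trees on vertex set $[n]$, let $B_1(z)=\sum_{n\ge0}b_{1,n}\frac{z^n}{n!}$, and let $B(z)=\sum_{n\ge0}b_n\frac{z^n}{n!}$ where $b_n$ is the number of labeled plane 1-2 trees on $[n]$ and $b_0=1$. Then $B_1$ satisfies \[B_1'(z)=2B_1(z)(B(z)-1)+B_1(z)+2z(B(z)-1)+z-z^2,\qquad B_1(0)=0,\] and consequently \[B_1(z)=\frac{6z^3+\sqrt3(3z^2-15z-5)\sin(\sqrt3 z)+3(3z^2+5z-5)\cos(\sqrt3 z)+15}{9\left(\sqrt3\sin(\sqrt3 z)-\cos(\sqrt3 z)-2\right)}.\]
   Context: A labeled plane 1-2 tree on vertex set $[n]=\{1,\dots,n\}$ is a rooted tree whose vertices are bijectively labeled by $[n]$, in which every vertex has at most two children, the label of each non-root vertex is less than the label of its parent, and the children of each vertex are linearly ordered. The rank of a vertex $v$ is the number of edges in a shortest path from $v$ to a leaf that is a descendant of $v$ (leaves have rank $0$). One has $B(z)=\frac12+\frac{\sqrt3}{2}\tan\left(\frac{\sqrt3}{2}z+\frac{\pi}{6}\right)$. *)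

theory Defs
  imports "HOL-Analysis.Analysis"
begin

text \<open>
  Finite rooted plane trees with labelled vertices. The children of a vertex form a list, hence
  are linearly ordered; an only child has no left/right position. Once all labels are distinct,
  two elements of this type are equal iff they are the same labelled plane tree.
\<close>
datatype ptree = Node (label: nat) (children: "ptree list")

text \<open>
  A vertex is represented by the subtree rooted at it. This is a list rather than a set, so that
  every vertex is listed exactly once, whatever its label.
\<close>
primrec vertices :: "ptree \<Rightarrow> ptree list" where
  "vertices (Node a ts) = Node a ts # concat (map vertices ts)"

definition labeled_plane_12_trees :: "nat \<Rightarrow> ptree set" where
  "labeled_plane_12_trees n = {t.
     distinct (map label (vertices t)) \<and> label ` set (vertices t) = {1..n} \<and>
     (\<forall>v\<in>set (vertices t). length (children v) \<le> 2 \<and>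
        (\<forall>c\<in>set (children v). label c < label v))}"

definition child_rel :: "(ptree \<times> ptree) set" where
  "child_rel = {(v, c). c \<in> set (children v)}"

definition is_leaf :: "ptree \<Rightarrow> bool" where
  "is_leaf v \<longleftrightarrow> children v = []"

text \<open>
  In a rooted tree the path from a vertex to one of its descendants is the descending one.
\<close>
definition vertex_rank :: "ptree \<Rightarrow> nat" where
  "vertex_rank v = (LEAST k. \<exists>l. is_leaf l \<and> (v, l) \<in> child_rel ^^ k)"

text \<open>There is no tree on the empty vertex set (every tree has a root); the value 1 at 0 is a convention.\<close>
definition tree_count :: "nat \<Rightarrow> nat" where
  "tree_count n = (if n = 0 then 1 else card (labeled_plane_12_trees n))"

definition rank1_count :: "nat \<Rightarrow> nat" where
  "rank1_count n = (\<Sum>t\<in>labeled_plane_12_trees n.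
             length (filter (\<lambda>v. vertex_rank v = 1) (vertices t)))"

definition egf :: "(nat \<Rightarrow> nat) \<Rightarrow> complex fps" where
  "egf a = Abs_fps (\<lambda>n. of_nat (a n) / fact n)"

end

theory Submission
  imports Defs
begin

text \<open>
  Deleting the root, which carries the largest label, leaves no tree, one tree, or an ordered pair
  of trees on complementary label sets, and a vertex has rank 1 exactly when one of its children is
  a leaf. With \<open>T = B - 1\<close> this gives \<open>T' = 1 + T + T\<^sup>2\<close> and the equation for \<open>B1\<close>, in which the
  exponential generating function \<open>z\<close> of single-vertex trees enters by inclusion and exclusion.
  Put \<open>D = s sin (s z) - cos (s z) - 2\<close>. The Riccati equation has the solution
  \<open>T = (1 - s sin (s z) - cos (s z)) / D\<close>, so \<open>2 T + 1 = - D' / D\<close>. Hence \<open>D\<close> is an integrating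
  factor: \<open>(D B1)' = - z D' - z\<^sup>2 D\<close>, which integrates to the closed form.
\<close>

subsection \<open>Decomposition at the root\<close>

abbreviation labels :: "ptree \<Rightarrow> nat set" where
  "labels t \<equiv> label ` set (vertices t)"

text \<open>The subtrees at the root of a tree on \<open>{1..n}\<close> carry arbitrary label sets,
  so the recursion needs trees on any set of labels.\<close>

definition trees_on :: "nat set \<Rightarrow> ptree set" where
  "trees_on S = {t.
     distinct (map label (vertices t)) \<and> labels t = S \<and>
     (\<forall>v\<in>set (vertices t). length (children v) \<le> 2 \<and>
        (\<forall>c\<in>set (children v). label c < label v))}"

lemma labeled_plane_12_trees_eq: "labeled_plane_12_trees n = trees_on {1..n}"
  by (simp add: labeled_plane_12_trees_def trees_on_def)

lemma self_in_vertices: "t \<in> set (vertices t)"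
  by (cases t) simp

text \<open>Labels grow towards the root along every path; the induction passes through the child
  whose subtree contains \<open>x\<close>.\<close>

lemma label_le_root:
  assumes "\<And>v c. v \<in> set (vertices t) \<Longrightarrow> c \<in> set (children v) \<Longrightarrow> label c < label v"
    and "x \<in> labels t"
  shows "x \<le> label t"
  using assms
proof (induction t)
  case (Node a ts)
  show ?case
  proof (cases "x = a")
    case False
    then obtain t where t: "t \<in> set ts" "x \<in> labels t"
      using Node.prems(2) by auto
    have "x \<le> label t"
      by (rule Node.IH[OF t(1) _ t(2)]) (use Node.prems(1) t(1) in auto)
    also have "label t < a"
      using Node.prems(1)[of "Node a ts" t] t(1) by simp
    finally show ?thesis by simp
  qed simp
qed

lemma trees_on_label_le: "t \<in> trees_on S \<Longrightarrow> x \<in> S \<Longrightarrow> x \<le> label t"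
  unfolding trees_on_def using label_le_root by blast

lemma trees_on_label_in: "t \<in> trees_on S \<Longrightarrow> label t \<in> S"
  unfolding trees_on_def using self_in_vertices by blast

lemma trees_on_empty: "trees_on {} = {}"
  using trees_on_label_in by blast

lemma trees_on_label_set_unique: "t \<in> trees_on A \<Longrightarrow> t \<in> trees_on B \<Longrightarrow> A = B"
  by (auto simp: trees_on_def)

lemma leaf_in_trees_on_iff: "Node a [] \<in> trees_on S \<longleftrightarrow> S = {a}"
  by (auto simp: trees_on_def)

text \<open>The root of \<open>t\<close> carries the maximum of its label set, so requiring
  \<open>label t < a\<close> amounts to requiring \<open>x < a\<close> for every label
  \<open>x\<close> of \<open>t\<close>. The binary case rests on the same remark.\<close>

lemma unary_in_trees_on_iff:
  "Node a [t] \<in> trees_on S \<longleftrightarrow> (\<exists>A. t \<in> trees_on A \<and> (\<forall>x\<in>A. x < a) \<and> S = insert a A)"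
proof
  assume *: "Node a [t] \<in> trees_on S"
  have "t \<in> trees_on (labels t)"
    using * by (auto simp: trees_on_def)
  moreover have "label t < a"
    using * by (auto simp: trees_on_def)
  moreover have "S = insert a (labels t)"
    using * by (auto simp: trees_on_def)
  ultimately show "\<exists>A. t \<in> trees_on A \<and> (\<forall>x\<in>A. x < a) \<and> S = insert a A"
    using trees_on_label_le le_less_trans by blast
next
  assume "\<exists>A. t \<in> trees_on A \<and> (\<forall>x\<in>A. x < a) \<and> S = insert a A"
  then obtain A where A: "t \<in> trees_on A" "\<forall>x\<in>A. x < a" "S = insert a A"
    by blast
  have "label t < a" using A trees_on_label_in by blast
  then show "Node a [t] \<in> trees_on S"
    using A by (auto simp: trees_on_def)
qed

lemma binary_in_trees_on_iff:
  "Node a [t, u] \<in> trees_on S \<longleftrightarrow>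
     (\<exists>A C. t \<in> trees_on A \<and> u \<in> trees_on C \<and> A \<inter> C = {} \<and> (\<forall>x\<in>A \<union> C. x < a) \<and> S = insert a (A \<union> C))"
proof
  assume *: "Node a [t, u] \<in> trees_on S"
  have t: "t \<in> trees_on (labels t)" and u: "u \<in> trees_on (labels u)"
    using * by (auto simp: trees_on_def)
  have "label t < a" "label u < a"
    using * by (auto simp: trees_on_def)
  then have "\<forall>x\<in>labels t \<union> labels u. x < a"
    using trees_on_label_le[OF t] trees_on_label_le[OF u] le_less_trans by blast
  moreover have "labels t \<inter> labels u = {}" "S = insert a (labels t \<union> labels u)"
    using * by (auto simp: trees_on_def)
  ultimately show "\<exists>A C. t \<in> trees_on A \<and> u \<in> trees_on C \<and> A \<inter> C = {} \<and>
      (\<forall>x\<in>A \<union> C. x < a) \<and> S = insert a (A \<union> C)"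
    using t u by blast
next
  assume "\<exists>A C. t \<in> trees_on A \<and> u \<in> trees_on C \<and> A \<inter> C = {} \<and>
      (\<forall>x\<in>A \<union> C. x < a) \<and> S = insert a (A \<union> C)"
  then obtain A C where A: "t \<in> trees_on A" "u \<in> trees_on C" "A \<inter> C = {}"
      "\<forall>x\<in>A \<union> C. x < a" "S = insert a (A \<union> C)"
    by blast
  have "label t < a" "label u < a" using A trees_on_label_in by blast+
  moreover have "a \<notin> labels t" "a \<notin> labels u" "labels t \<inter> labels u = {}"
    using A by (auto simp: trees_on_def)
  ultimately show "Node a [t, u] \<in> trees_on S"
    using A by (auto simp: trees_on_def)
qed

lemma trees_on_cases:
  assumes "t \<in> trees_on S"
  obtains a where "t = Node a []" | a u where "t = Node a [u]" | a u v where "t = Node a [u, v]"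
proof -
  obtain a ts where t: "t = Node a ts" by (cases t)
  have "length ts \<le> 2"
    using assms t by (auto simp: trees_on_def)
  then consider "ts = []" | u where "ts = [u]" | u v where "ts = [u, v]"
    by (cases ts rule: remdups_adj.cases) (auto simp: neq_Nil_conv)
  then show ?thesis using that t by cases auto
qed

text \<open>The largest label \<open>m\<close> is forced to sit at the root. The extreme choices
  \<open>A = {}\<close> and \<open>A = S\<close> may stay in \<open>Pow S\<close>: since
  \<open>trees_on {}\<close> is empty, they contribute nothing.\<close>

lemma trees_on_insert:
  assumes less: "\<And>x. x \<in> S \<Longrightarrow> x < m"
  shows "trees_on (insert m S) =
    ((if S = {} then {Node m []} else {}) \<union> (\<lambda>t. Node m [t]) ` trees_on S) \<union>
    (\<lambda>(A, t, u). Node m [t, u]) ` (SIGMA A:Pow S. trees_on A \<times> trees_on (S - A))"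
    (is "?L = ?R")
proof (intro set_eqI iffI)
  \<comment> \<open>Both \<open>a\<close> and \<open>m\<close> are the maximum of the same set,
    hence equal; removing them leaves \<open>A = S\<close>.\<close>
  have uniq: "a = m \<and> A = S" if "insert m S = insert a A" "\<forall>x\<in>A. x < a" for a A
  proof -
    have "a = m"
      using that less by (metis insertE insertI1 order_less_asym)
    moreover have "m \<notin> S" "a \<notin> A" using that less by blast+
    ultimately show ?thesis using that by (metis insert_ident)
  qed
  {
    fix t assume t: "t \<in> ?L"
    then show "t \<in> ?R"
    proof (cases rule: trees_on_cases)
      case (1 a)
      then show ?thesis using uniq[of a "{}"] t by (auto simp: leaf_in_trees_on_iff)
    next
      case (2 a u)
      then obtain A where "u \<in> trees_on A" "\<forall>x\<in>A. x < a" "insert m S = insert a A"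
        using t by (auto simp: unary_in_trees_on_iff)
      then show ?thesis using uniq[of a A] 2 by auto
    next
      case (3 a u v)
      have "Node a [u, v] \<in> trees_on (insert m S)" using t 3 by simp
      from this[unfolded binary_in_trees_on_iff]
      obtain A C where *: "u \<in> trees_on A" "v \<in> trees_on C" "A \<inter> C = {}"
          "\<forall>x\<in>A \<union> C. x < a" "insert m S = insert a (A \<union> C)"
        by (elim exE conjE) (rule that)
      then have "a = m" "S = A \<union> C" using uniq[of a "A \<union> C"] by blast+
      then have "A \<in> Pow S" "C = S - A" using *(3) by blast+
      then have "(A, u, v) \<in> (SIGMA A:Pow S. trees_on A \<times> trees_on (S - A))"
        using *(1,2) by blast
      then have "(\<lambda>(A, t, u). Node m [t, u]) (A, u, v) \<in> ?R" by (intro UnI2 imageI)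
      then show ?thesis by (simp only: 3 \<open>a = m\<close> prod.case)
    qed
  next
    fix t assume "t \<in> ?R"
    then consider "S = {}" "t = Node m []" | u where "u \<in> trees_on S" "t = Node m [u]"
      | A u v where "A \<subseteq> S" "u \<in> trees_on A" "v \<in> trees_on (S - A)" "t = Node m [u, v]"
      by (auto split: if_splits)
    then show "t \<in> ?L"
    proof cases
      case 1
      then show ?thesis by (simp add: leaf_in_trees_on_iff)
    next
      case 2
      then show ?thesis using less by (auto simp: unary_in_trees_on_iff)
    next
      case (3 A u v)
      have "insert m S = insert m (A \<union> (S - A))" "A \<inter> (S - A) = {}" "\<forall>x\<in>A \<union> (S - A). x < m"
        using 3(1) less by blast+
      then show ?thesis using 3 unfolding 3(4) binary_in_trees_on_iff by blast
    qed
  }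
qed

lemma finite_nat_set_cases:
  fixes S :: "nat set"
  assumes "finite S" "S \<noteq> {}"
  obtains m S' where "S = insert m S'" "finite S'" "\<And>x. x \<in> S' \<Longrightarrow> x < m"
proof (rule that)
  show "S = insert (Max S) (S - {Max S})"
    using Max_in[OF assms] by blast
  show "finite (S - {Max S})" using assms by simp
  show "x < Max S" if "x \<in> S - {Max S}" for x
    using Max_ge[OF assms(1), of x] that by simp
qed

text \<open>Strong induction is needed because binary roots involve every subset of the labels below
  the maximum.\<close>

lemma finite_trees_on: "finite S \<Longrightarrow> finite (trees_on S)"
proof (induction S rule: finite_psubset_induct)
  case (psubset S)
  show ?case
  proof (cases "S = {}")
    case False
    then obtain m S' where S: "S = insert m S'" "finite S'" and less: "\<And>x. x \<in> S' \<Longrightarrow> x < m"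
      using finite_nat_set_cases psubset.hyps by metis
    have "finite (trees_on A)" if "A \<subseteq> S'" for A
      by (rule psubset.IH) (use that less in \<open>auto simp: S(1)\<close>)
    then have "finite (trees_on (insert m S'))"
      using S(2) by (subst trees_on_insert[OF less]) (auto intro!: finite_SigmaI)
    then show ?thesis using S(1) by simp
  qed (simp add: trees_on_empty)
qed

subsection \<open>Recursions for sums over trees\<close>

text \<open>A general weight \<open>w\<close> serves both counts: the constant 1 counts trees,
  \<open>rank1_number\<close> counts vertices of rank 1. The three classes are disjoint because
  their roots have different numbers of children.\<close>

lemma sum_trees_on_insert:
  fixes w :: "ptree \<Rightarrow> 'a::comm_monoid_add"
  assumes less: "\<And>x. x \<in> S \<Longrightarrow> x < m" and S: "finite S"
  shows "(\<Sum>t\<in>trees_on (insert m S). w t) =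
    (if S = {} then w (Node m []) else 0) + (\<Sum>t\<in>trees_on S. w (Node m [t])) +
    (\<Sum>A\<in>Pow S. \<Sum>t\<in>trees_on A. \<Sum>u\<in>trees_on (S - A). w (Node m [t, u]))"
proof -
  let ?L = "if S = {} then {Node m []} else {}"
  let ?U = "(\<lambda>t. Node m [t]) ` trees_on S"
  let ?P = "SIGMA A:Pow S. trees_on A \<times> trees_on (S - A)"
  let ?B = "(\<lambda>(A, t, u). Node m [t, u]) ` ?P"
  have fin: "finite (trees_on A)" if "A \<subseteq> S" for A
    using that S finite_trees_on finite_subset by blast
  have finP: "finite ?P"
    using S fin by (auto intro!: finite_SigmaI)
  \<comment> \<open>The component \<open>A\<close> is recovered from the tree as the label set of
    its first subtree.\<close>
  have inj: "inj_on (\<lambda>(A, t, u). Node m [t, u]) ?P"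
    using trees_on_label_set_unique by (auto simp: inj_on_def)
  have "sum w (trees_on (insert m S)) = sum w ((?L \<union> ?U) \<union> ?B)"
    by (subst trees_on_insert[OF less]) auto
  also have "\<dots> = sum w (?L \<union> ?U) + sum w ?B"
    by (rule sum.union_disjoint) (use finP fin in \<open>auto split: if_splits\<close>)
  also have "sum w (?L \<union> ?U) = sum w ?L + sum w ?U"
    by (rule sum.union_disjoint) (use finP fin in \<open>auto split: if_splits\<close>)
  also have "sum w ?L = (if S = {} then w (Node m []) else 0)"
    by simp
  also have "sum w ?U = (\<Sum>t\<in>trees_on S. w (Node m [t]))"
    by (subst sum.reindex) (auto simp: inj_on_def)
  also have "sum w ?B = (\<Sum>(A, t, u)\<in>?P. w (Node m [t, u]))"
    by (subst sum.reindex[OF inj]) (simp add: o_def case_prod_unfold)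
  also have "\<dots> = (\<Sum>A\<in>Pow S. \<Sum>(t, u)\<in>trees_on A \<times> trees_on (S - A). w (Node m [t, u]))"
    by (subst sum.Sigma[symmetric]) (use S fin in auto)
  also have "\<dots> = (\<Sum>A\<in>Pow S. \<Sum>t\<in>trees_on A. \<Sum>u\<in>trees_on (S - A). w (Node m [t, u]))"
    by (simp add: sum.cartesian_product)
  finally show ?thesis .
qed

text \<open>Grouping subsets by size turns a sum over splittings of \<open>S\<close> into a binomial
  convolution, the coefficient form of a product of exponential generating functions.\<close>

lemma sum_Pow_card:
  fixes f :: "nat \<Rightarrow> nat \<Rightarrow> 'a::semiring_1"
  assumes "finite S"
  shows "(\<Sum>A\<in>Pow S. f (card A) (card (S - A))) =
    (\<Sum>k\<le>card S. of_nat (card S choose k) * f k (card S - k))"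
proof -
  have "(\<Sum>A\<in>Pow S. f (card A) (card (S - A))) =
      (\<Sum>k\<le>card S. \<Sum>A\<in>{A \<in> Pow S. card A = k}. f (card A) (card (S - A)))"
    by (rule sum.group[symmetric]) (use assms in \<open>auto intro: card_mono\<close>)
  also have "\<dots> = (\<Sum>k\<le>card S. \<Sum>A\<in>{A \<in> Pow S. card A = k}. f k (card S - k))"
    by (intro sum.cong refl) (use assms in \<open>auto simp: card_Diff_subset finite_subset\<close>)
  also have "\<dots> = (\<Sum>k\<le>card S. of_nat (card S choose k) * f k (card S - k))"
    using n_subsets[OF assms] by simp
  finally show ?thesis .
qed

section \<open>Vertices of rank 1\<close>

definition rank1_number :: "ptree \<Rightarrow> nat" where
  "rank1_number t = length (filter (\<lambda>v. vertex_rank v = 1) (vertices t))"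

text \<open>Ensures that the \<open>LEAST\<close> in \<open>vertex_rank\<close> is attained:
  descending through first children ends in a leaf.\<close>

lemma ex_leaf: "\<exists>k l. is_leaf l \<and> (v, l) \<in> child_rel ^^ k"
proof (induction v)
  case (Node a ts)
  show ?case
  proof (cases ts)
    case Nil
    then have "is_leaf (Node a ts) \<and> (Node a ts, Node a ts) \<in> child_rel ^^ 0"
      by (simp add: is_leaf_def)
    then show ?thesis by blast
  next
    case (Cons t us)
    then obtain k l where "is_leaf l" "(t, l) \<in> child_rel ^^ k"
      using Node.IH[of t] by auto
    moreover have "(Node a ts, t) \<in> child_rel" using Cons by (simp add: child_rel_def)
    ultimately show ?thesis by (metis relpow_Suc_I2)
  qed
qed

text \<open>A leaf child is a leaf at distance 1, and a vertex that has a child is not a leaf, which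
  rules out distance 0.\<close>

lemma vertex_rank_eq_1_iff: "vertex_rank v = 1 \<longleftrightarrow> (\<exists>c\<in>set (children v). is_leaf c)"
proof -
  let ?P = "\<lambda>k. \<exists>l. is_leaf l \<and> (v, l) \<in> child_rel ^^ k"
  have P0: "?P 0 \<longleftrightarrow> is_leaf v" by simp
  have P1: "?P 1 \<longleftrightarrow> (\<exists>c\<in>set (children v). is_leaf c)"
    by (auto simp: child_rel_def)
  have "?P (vertex_rank v)"
    unfolding vertex_rank_def by (rule LeastI_ex) (rule ex_leaf)
  then have "vertex_rank v = 1 \<Longrightarrow> ?P 1" by simp
  moreover have "vertex_rank v = 1" if "?P 1"
    unfolding vertex_rank_def
  proof (rule Least_equality)
    show "?P 1" by (fact that)
    have "\<not> ?P 0" using that unfolding P0 P1 by (auto simp: is_leaf_def)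
    then show "1 \<le> k" if "?P k" for k
      using that by (cases k) auto
  qed
  ultimately show ?thesis unfolding P1 by blast
qed

text \<open>The rank of a vertex depends only on the subtree below it, so attaching a new root
  leaves all other ranks unchanged.\<close>

lemma rank1_number_Node:
  "rank1_number (Node a ts) = of_bool (\<exists>t\<in>set ts. is_leaf t) + (\<Sum>t\<leftarrow>ts. rank1_number t)"
  unfolding rank1_number_def
  by (simp add: vertex_rank_eq_1_iff[simplified] filter_concat length_concat o_def)

section \<open>Sums over trees depend only on the number of labels\<close>

lemma sum_Pow_cong_card:
  assumes "finite S" "finite S'" "card S = card S'"
    and F: "\<And>A A'. A \<subseteq> S \<Longrightarrow> A' \<subseteq> S' \<Longrightarrow> card A = card A' \<Longrightarrow> card (S - A) = card (S' - A') \<Longrightarrow>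
      F A (S - A) = F A' (S' - A')"
  shows "(\<Sum>A\<in>Pow S. F A (S - A)) = (\<Sum>A\<in>Pow S'. F A (S' - A))"
proof -
  \<comment> \<open>A bijection between the ground sets induces one between their power sets that
    preserves the sizes of subsets and of complements.\<close>
  obtain h where h: "bij_betw h S S'"
    using finite_same_card_bij assms(1-3) by blast
  have "(\<Sum>A\<in>Pow S. F A (S - A)) = (\<Sum>A\<in>Pow S. F (h ` A) (S' - h ` A))"
  proof (intro sum.cong refl F)
    fix A assume "A \<in> Pow S"
    then have A: "A \<subseteq> S" by simp
    have "inj_on h A" using h A by (meson bij_betw_def inj_on_subset)
    then show card: "card A = card (h ` A)" by (simp add: card_image)
    show "A \<subseteq> S" by fact
    show "h ` A \<subseteq> S'" using h A by (auto simp: bij_betw_def)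
    then show "card (S - A) = card (S' - h ` A)"
      using A assms(1-3) card by (simp add: card_Diff_subset finite_subset)
  qed
  also have "\<dots> = (\<Sum>A\<in>Pow S'. F A (S' - A))"
    by (rule sum.reindex_bij_betw[OF bij_betw_Pow[OF h]])
  finally show ?thesis .
qed

text \<open>Replaces an explicit order-preserving relabelling of trees: if the value after adding a
  new maximum is determined by the values on subsets of the rest, only cardinality matters.\<close>

lemma card_determined_induct:
  fixes f :: "nat set \<Rightarrow> 'a"
  assumes step: "\<And>S S' m m'. finite S \<Longrightarrow> finite S' \<Longrightarrow> card S = card S' \<Longrightarrow>
      (\<And>x. x \<in> S \<Longrightarrow> x < m) \<Longrightarrow> (\<And>x. x \<in> S' \<Longrightarrow> x < m') \<Longrightarrow>
      (\<And>A A'. A \<subseteq> S \<Longrightarrow> A' \<subseteq> S' \<Longrightarrow> card A = card A' \<Longrightarrow> f A = f A') \<Longrightarrow>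
      f (insert m S) = f (insert m' S')"
    and "finite S" "finite S'" "card S = card S'"
  shows "f S = f S'"
  using assms(2-4)
proof (induction S arbitrary: S' rule: finite_psubset_induct)
  case (psubset S)
  show ?case
  proof (cases "S = {}")
    case False
    then obtain m U where S: "S = insert m U" "finite U" and less: "\<And>x. x \<in> U \<Longrightarrow> x < m"
      using finite_nat_set_cases psubset.hyps by metis
    have "S' \<noteq> {}" using False psubset.hyps psubset.prems by auto
    then obtain m' U' where S': "S' = insert m' U'" "finite U'" and less': "\<And>x. x \<in> U' \<Longrightarrow> x < m'"
      using finite_nat_set_cases psubset.prems by metis
    have "m \<notin> U" "m' \<notin> U'" using less less' by blast+
    then have card: "card U = card U'" using S S' psubset.prems by simp
    have "f (insert m U) = f (insert m' U')"
    proof (rule step[OF S(2) S'(2) card less less'])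
      fix A A' assume "A \<subseteq> U" "A' \<subseteq> U'" "card A = card A'"
      then show "f A = f A'"
        using S S' \<open>m \<notin> U\<close> by (intro psubset.IH) (auto intro: finite_subset)
    qed
    then show ?thesis using S(1) S'(1) by simp
  next
    case True
    then show ?thesis using psubset.prems by auto
  qed
qed

text \<open>Complex values allow the subtraction in the inclusion-exclusion below. At the empty set
  the value is 0, unlike the convention \<open>tree_count 0 = 1\<close>.\<close>

definition tree_sum :: "nat set \<Rightarrow> complex" where
  "tree_sum S = of_nat (card (trees_on S))"

definition rank1_sum :: "nat set \<Rightarrow> complex" where
  "rank1_sum S = (\<Sum>t\<in>trees_on S. of_nat (rank1_number t))"

text \<open>A tree whose root is a leaf is a single vertex, and there is exactly one on each
  singleton. The indicator on the right has exponential generating function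
  \<open>fps_X\<close>.\<close>

lemma leaf_sum:
  assumes "finite S"
  shows "(\<Sum>t\<in>trees_on S. of_bool (is_leaf t)) = (of_bool (card S = 1) :: 'a::semiring_1)"
proof (cases "card S = 1")
  case True
  then obtain a where "S = {a}" by (auto simp: card_1_singleton_iff)
  moreover have "trees_on {a} = {Node a []}"
    by (subst trees_on_insert) (auto simp: trees_on_empty)
  ultimately show ?thesis by (simp add: is_leaf_def)
next
  case False
  have "\<not> is_leaf t" if "t \<in> trees_on S" for t
    using that False by (cases t) (auto simp: is_leaf_def leaf_in_trees_on_iff)
  then show ?thesis using False by simp
qed

lemma tree_sum_insert:
  assumes "\<And>x. x \<in> S \<Longrightarrow> x < m" "finite S"
  shows "tree_sum (insert m S) =
    of_bool (S = {}) + tree_sum S + (\<Sum>A\<in>Pow S. tree_sum A * tree_sum (S - A))"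
  using sum_trees_on_insert[OF assms, of "\<lambda>_. 1 :: complex"]
  by (auto simp: tree_sum_def)

text \<open>A root with children \<open>t\<close> and \<open>u\<close> has rank 1 iff
  \<open>t\<close> or \<open>u\<close> is a leaf. The indicator of this disjunction is the sum of
  the two indicators minus their product, and each resulting term factors over the two
  subtrees.\<close>

lemma rank1_sum_insert:
  assumes "\<And>x. x \<in> S \<Longrightarrow> x < m" "finite S"
  defines "l \<equiv> \<lambda>A. of_bool (card A = 1)"
  shows "rank1_sum (insert m S) = l S + rank1_sum S +
    (\<Sum>A\<in>Pow S. l A * tree_sum (S - A) + tree_sum A * l (S - A) - l A * l (S - A) +
       rank1_sum A * tree_sum (S - A) + tree_sum A * rank1_sum (S - A))"
proof -
  have one: "(\<Sum>t\<in>trees_on S. of_nat (rank1_number (Node m [t]))) = l S + rank1_sum S"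
    by (simp add: rank1_number_Node sum.distrib leaf_sum[OF \<open>finite S\<close>] rank1_sum_def l_def)
  have two: "(\<Sum>t\<in>trees_on A. \<Sum>u\<in>trees_on (S - A). of_nat (rank1_number (Node m [t, u]))) =
      l A * tree_sum (S - A) + tree_sum A * l (S - A) - l A * l (S - A) +
       rank1_sum A * tree_sum (S - A) + tree_sum A * rank1_sum (S - A)" (is "?lhs = _")
    if "A \<in> Pow S" for A
  proof -
    let ?b = "\<lambda>t. of_bool (is_leaf t) :: complex" and ?r = "\<lambda>t. of_nat (rank1_number t) :: complex"
    have fin: "finite A" "finite (S - A)" using that assms(2) finite_subset by auto
    \<comment> \<open>The factors 1 give every single-variable term the product shape required by
      \<open>sum_product\<close>.\<close>
    have "?lhs = (\<Sum>t\<in>trees_on A. \<Sum>u\<in>trees_on (S - A).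
        ?b t * 1 + 1 * ?b u - ?b t * ?b u + ?r t * 1 + 1 * ?r u)"
      by (intro sum.cong refl) (simp add: rank1_number_Node)
    also have "\<dots> = (\<Sum>t\<in>trees_on A. ?b t) * (\<Sum>u\<in>trees_on (S - A). 1) +
        (\<Sum>t\<in>trees_on A. 1) * (\<Sum>u\<in>trees_on (S - A). ?b u) -
        (\<Sum>t\<in>trees_on A. ?b t) * (\<Sum>u\<in>trees_on (S - A). ?b u) +
        (\<Sum>t\<in>trees_on A. ?r t) * (\<Sum>u\<in>trees_on (S - A). 1) +
        (\<Sum>t\<in>trees_on A. 1) * (\<Sum>u\<in>trees_on (S - A). ?r u)"
      unfolding sum_product by (simp only: sum.distrib sum_subtractf)
    finally show ?thesis
      unfolding leaf_sum[OF fin(1)] leaf_sum[OF fin(2)]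
      by (simp add: tree_sum_def rank1_sum_def l_def)
  qed
  have "rank1_number (Node m []) = 0" by (simp add: rank1_number_Node)
  then show ?thesis
    using sum_trees_on_insert[OF assms(1,2), of "\<lambda>t. of_nat (rank1_number t) :: complex"]
    unfolding one by (simp add: rank1_sum_def[of "insert m S"] two)
qed

lemma tree_sum_card_cong:
  assumes "finite S" "finite S'" "card S = card S'"
  shows "tree_sum S = tree_sum S'"
proof (rule card_determined_induct[OF _ assms])
  fix S S' :: "nat set" and m m'
  assume fin: "finite S" "finite S'" "card S = card S'"
    and less: "\<And>x. x \<in> S \<Longrightarrow> x < m" "\<And>x. x \<in> S' \<Longrightarrow> x < m'"
    and IH: "\<And>A A'. A \<subseteq> S \<Longrightarrow> A' \<subseteq> S' \<Longrightarrow> card A = card A' \<Longrightarrow> tree_sum A = tree_sum A'"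
  have "S = {} \<longleftrightarrow> S' = {}" using fin by (metis card_0_eq)
  moreover have "tree_sum S = tree_sum S'" using IH fin by blast
  moreover have "(\<Sum>A\<in>Pow S. tree_sum A * tree_sum (S - A)) =
      (\<Sum>A\<in>Pow S'. tree_sum A * tree_sum (S' - A))"
    by (rule sum_Pow_cong_card[OF fin, where F = "\<lambda>A C. tree_sum A * tree_sum C"])
      (metis IH Diff_subset)
  ultimately show "tree_sum (insert m S) = tree_sum (insert m' S')"
    by (simp add: tree_sum_insert[OF less(1) fin(1)] tree_sum_insert[OF less(2) fin(2)])
qed

lemma rank1_sum_card_cong:
  assumes "finite S" "finite S'" "card S = card S'"
  shows "rank1_sum S = rank1_sum S'"
proof (rule card_determined_induct[OF _ assms])
  fix S S' :: "nat set" and m m'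
  assume fin: "finite S" "finite S'" "card S = card S'"
    and less: "\<And>x. x \<in> S \<Longrightarrow> x < m" "\<And>x. x \<in> S' \<Longrightarrow> x < m'"
    and IH: "\<And>A A'. A \<subseteq> S \<Longrightarrow> A' \<subseteq> S' \<Longrightarrow> card A = card A' \<Longrightarrow> rank1_sum A = rank1_sum A'"
  let ?l = "\<lambda>A::nat set. of_bool (card A = 1) :: complex"
  let ?F = "\<lambda>A C. ?l A * tree_sum C + tree_sum A * ?l C - ?l A * ?l C +
       rank1_sum A * tree_sum C + tree_sum A * rank1_sum C"
  have "rank1_sum S = rank1_sum S'" using IH fin by blast
  moreover have "(\<Sum>A\<in>Pow S. ?F A (S - A)) = (\<Sum>A\<in>Pow S'. ?F A (S' - A))"
  proof (rule sum_Pow_cong_card[OF fin, where F = ?F])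
    fix A A' assume A: "A \<subseteq> S" "A' \<subseteq> S'" and card: "card A = card A'" "card (S - A) = card (S' - A')"
    \<comment> \<open>The tree counts are already known to depend on cardinality alone; the
      induction hypothesis is reserved for \<open>rank1_sum\<close>.\<close>
    have "tree_sum A = tree_sum A'" "tree_sum (S - A) = tree_sum (S' - A')"
      by (rule tree_sum_card_cong; use A card fin in \<open>auto intro: finite_subset\<close>)+
    moreover have "rank1_sum A = rank1_sum A'" "rank1_sum (S - A) = rank1_sum (S' - A')"
      using IH A card by (metis Diff_subset)+
    ultimately show "?F A (S - A) = ?F A' (S' - A')" using card by simp
  qed
  ultimately show "rank1_sum (insert m S) = rank1_sum (insert m' S')"
    by (simp add: rank1_sum_insert[OF less(1) fin(1)] rank1_sum_insert[OF less(2) fin(2)] fin(3))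
qed

section \<open>Binomial recursions on initial segments\<close>

lemma tree_sum_rec:
  "tree_sum {1..Suc n} = of_bool (n = 0) + tree_sum {1..n} +
    (\<Sum>k\<le>n. of_nat (n choose k) * (tree_sum {1..k} * tree_sum {1..n - k}))"
proof -
  have ins: "{1..Suc n} = insert (Suc n) {1..n}" by auto
  have "tree_sum {1..Suc n} = of_bool ({1..n} = {}) + tree_sum {1..n} +
      (\<Sum>A\<in>Pow {1..n}. tree_sum A * tree_sum ({1..n} - A))"
    unfolding ins by (rule tree_sum_insert) auto
  \<comment> \<open>Each part of the splitting is replaced by the initial segment of the same size,
    so that subsets of equal size can be collected.\<close>
  also have "(\<Sum>A\<in>Pow {1..n}. tree_sum A * tree_sum ({1..n} - A)) =
      (\<Sum>A\<in>Pow {1..n}. tree_sum {1..card A} * tree_sum {1..card ({1..n} - A)})"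
    by (intro sum.cong refl arg_cong2[where f = "(*)"] tree_sum_card_cong)
      (auto intro: finite_subset)
  also have "\<dots> = (\<Sum>k\<le>n. of_nat (n choose k) * (tree_sum {1..k} * tree_sum {1..n - k}))"
    using sum_Pow_card[of "{1..n}" "\<lambda>i j. tree_sum {1..i} * tree_sum {1..j}"] by simp
  also have "{1..n} = {} \<longleftrightarrow> n = 0" by auto
  finally show ?thesis .
qed

lemma rank1_sum_rec:
  defines "l \<equiv> \<lambda>n. of_bool (n = 1)"
  shows "rank1_sum {1..Suc n} = l n + rank1_sum {1..n} +
    (\<Sum>k\<le>n. of_nat (n choose k) * (l k * tree_sum {1..n - k} + tree_sum {1..k} * l (n - k) -
       l k * l (n - k) + rank1_sum {1..k} * tree_sum {1..n - k} + tree_sum {1..k} * rank1_sum {1..n - k}))"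
proof -
  let ?F = "\<lambda>A C. l (card A) * tree_sum C + tree_sum A * l (card C) - l (card A) * l (card C) +
       rank1_sum A * tree_sum C + tree_sum A * rank1_sum C"
  let ?f = "\<lambda>i j. l i * tree_sum {1..j} + tree_sum {1..i} * l j -
       l i * l j + rank1_sum {1..i} * tree_sum {1..j} + tree_sum {1..i} * rank1_sum {1..j}"
  have ins: "{1..Suc n} = insert (Suc n) {1..n}" by auto
  have "rank1_sum {1..Suc n} = l n + rank1_sum {1..n} + (\<Sum>A\<in>Pow {1..n}. ?F A ({1..n} - A))"
    unfolding ins using rank1_sum_insert[of "{1..n}" "Suc n"] by (simp add: l_def)
  also have "(\<Sum>A\<in>Pow {1..n}. ?F A ({1..n} - A)) =
      (\<Sum>A\<in>Pow {1..n}. ?f (card A) (card ({1..n} - A)))"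
  proof (intro sum.cong refl)
    fix A assume A: "A \<in> Pow {1..n}"
    have "C \<subseteq> {1..n} \<Longrightarrow> tree_sum C = tree_sum {1..card C} \<and> rank1_sum C = rank1_sum {1..card C}" for C
      by (auto intro!: tree_sum_card_cong rank1_sum_card_cong intro: finite_subset)
    from this[of A] this[of "{1..n} - A"] A
    show "?F A ({1..n} - A) = ?f (card A) (card ({1..n} - A))"
      by auto
  qed
  also have "\<dots> = (\<Sum>k\<le>n. of_nat (n choose k) * ?f k (n - k))"
    using sum_Pow_card[of "{1..n}" ?f] by simp
  finally show ?thesis .
qed

subsection \<open>Generating functions\<close>

text \<open>Unlike \<open>egf\<close>, admits coefficients from any field of characteristic 0, so
  differences of sequences are covered.\<close>

definition fps_egf :: "(nat \<Rightarrow> 'a) \<Rightarrow> 'a::field_char_0 fps" where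
  "fps_egf a = Abs_fps (\<lambda>n. a n / fact n)"

lemma fps_egf_mult:
  "fps_egf a * fps_egf b = fps_egf (\<lambda>n. \<Sum>k\<le>n. of_nat (n choose k) * (a k * b (n - k)))"
proof (rule fps_ext)
  fix n
  have "a k / fact k * (b (n - k) / fact (n - k)) =
      of_nat (n choose k) * (a k * b (n - k)) / fact n" if "k \<le> n" for k
    using binomial_fact[OF that, where 'a = 'a] by (simp add: field_simps)
  then show "fps_nth (fps_egf a * fps_egf b) n =
      fps_nth (fps_egf (\<lambda>n. \<Sum>k\<le>n. of_nat (n choose k) * (a k * b (n - k)))) n"
    by (simp add: fps_egf_def fps_mult_nth atMost_atLeast0 sum_divide_distrib)
qed

lemma fps_egf_add: "fps_egf a + fps_egf b = fps_egf (\<lambda>n. a n + b n)"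
  by (simp add: fps_egf_def fps_eq_iff add_divide_distrib)

lemma fps_egf_diff: "fps_egf a - fps_egf b = fps_egf (\<lambda>n. a n - b n)"
  by (simp add: fps_egf_def fps_eq_iff diff_divide_distrib)

lemma fps_deriv_egf: "fps_deriv (fps_egf a) = fps_egf (\<lambda>n. a (Suc n))"
  by (simp add: fps_egf_def fps_eq_iff del: of_nat_Suc)

lemma fps_egf_of_bool_0: "fps_egf (\<lambda>n. of_bool (n = 0)) = 1"
  by (simp add: fps_egf_def fps_eq_iff)

lemma fps_egf_of_bool_1: "fps_egf (\<lambda>n. of_bool (n = 1)) = fps_X"
  by (simp add: fps_egf_def fps_eq_iff fps_X_def)

text \<open>The summand 1 is the conventional value of \<open>tree_count\<close> at 0.\<close>

lemma egf_tree_count: "egf tree_count = 1 + fps_egf (\<lambda>n. tree_sum {1..n})"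
  by (auto simp: egf_def fps_egf_def fps_eq_iff tree_count_def tree_sum_def
      labeled_plane_12_trees_eq trees_on_empty)

lemma egf_rank1_count: "egf rank1_count = fps_egf (\<lambda>n. rank1_sum {1..n})"
  by (simp add: egf_def fps_egf_def rank1_count_def rank1_sum_def rank1_number_def
      labeled_plane_12_trees_eq)

text \<open>Differentiation shifts the index, which matches deleting the root; the three terms stand
  for no child, one child and two ordered children.\<close>

lemma deriv_tree_egf:
  defines "T \<equiv> fps_egf (\<lambda>n. tree_sum {1..n})"
  shows "fps_deriv T = 1 + T + T\<^sup>2"
  unfolding T_def fps_deriv_egf tree_sum_rec power2_eq_square fps_egf_mult
    fps_egf_of_bool_0[symmetric] fps_egf_add ..

text \<open>The initial \<open>fps_X\<close> is an only child that is a leaf, the products with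
  \<open>T\<close> are a leaf as first or second child, and \<open>fps_X * fps_X\<close> corrects
  for two leaves.\<close>

lemma deriv_rank1_egf:
  defines "T \<equiv> fps_egf (\<lambda>n. tree_sum {1..n})" and "R \<equiv> fps_egf (\<lambda>n. rank1_sum {1..n})"
  shows "fps_deriv R = fps_X + R + (fps_X * T + T * fps_X - fps_X * fps_X + R * T + T * R)"
  unfolding T_def R_def fps_deriv_egf rank1_sum_rec fps_egf_of_bool_1[symmetric] fps_egf_mult
    fps_egf_add fps_egf_diff
  by (simp only: distrib_left right_diff_distrib sum.distrib sum_subtractf)

text \<open>The equation determines coefficient \<open>k + 1\<close> of \<open>V\<close> from the
  coefficients up to \<open>k\<close>. Both closed forms are obtained by applying this to the
  difference of the two sides; \<open>K\<close> may be any series, even one built from the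
  unknown.\<close>

lemma fps_linear_ode_zero:
  fixes V K :: "'a::field_char_0 fps"
  assumes "fps_deriv V = K * V" "fps_nth V 0 = 0"
  shows "V = 0"
proof -
  have "fps_nth V n = 0" for n
  proof (induction n rule: less_induct)
    case (less n)
    show ?case
    proof (cases n)
      case (Suc k)
      have "of_nat (Suc k) * fps_nth V (Suc k) = fps_nth (fps_deriv V) k"
        by simp
      also have "\<dots> = (\<Sum>i=0..k. fps_nth K i * fps_nth V (k - i))"
        by (simp only: assms(1) fps_mult_nth)
      also have "\<dots> = 0"
        using less Suc by (intro sum.neutral) auto
      finally show ?thesis using Suc by (simp del: of_nat_Suc)
    qed (use assms in simp)
  qed
  then show ?thesis by (simp add: fps_eq_iff)
qed

theorem theorem3p2:
  fixes B B1 :: "complex fps" and s :: complex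
  defines "B \<equiv> egf tree_count" and "B1 \<equiv> egf rank1_count" and "s \<equiv> complex_of_real (sqrt 3)"
  shows "fps_deriv B1 = 2 * B1 * (B - 1) + B1 + 2 * fps_X * (B - 1) + fps_X - fps_X ^ 2
       \<and> fps_nth B1 0 = 0
       \<and> (\<lambda>z. (6 * z ^ 3 + s * (3 * z ^ 2 - 15 * z - 5) * sin (s * z)
                + 3 * (3 * z ^ 2 + 5 * z - 5) * cos (s * z) + 15)
              / (9 * (s * sin (s * z) - cos (s * z) - 2))) has_fps_expansion B1"
proof -
  define T where "T = fps_egf (\<lambda>n. tree_sum {1..n})"
  have B: "B - 1 = T" by (simp add: B_def T_def egf_tree_count)
  have T': "fps_deriv T = 1 + T + T\<^sup>2" unfolding T_def by (rule deriv_tree_egf)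
  have T0: "fps_nth T 0 = 0" by (simp add: T_def fps_egf_def tree_sum_def trees_on_empty)
  have B1': "fps_deriv B1 = fps_X + B1 + (fps_X * T + T * fps_X - fps_X * fps_X + B1 * T + T * B1)"
    unfolding T_def B1_def egf_rank1_count by (rule deriv_rank1_egf)
  have B10: "fps_nth B1 0 = 0"
    by (simp add: B1_def egf_rank1_count fps_egf_def rank1_sum_def trees_on_empty)
  have ode: "fps_deriv B1 = 2 * B1 * T + B1 + 2 * fps_X * T + fps_X - fps_X ^ 2"
    unfolding B1' by (simp add: algebra_simps power2_eq_square)

  \<comment> \<open>Solving the differential equations in closed form\<close>
  define \<sigma> where "\<sigma> = fps_const s"
  define S where "S = fps_sin s"
  define C where "C = fps_cos s"
  define X where "X = (fps_X :: complex fps)"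
  have "s * s = 3" by (simp add: s_def flip: of_real_mult)
  then have \<sigma>: "\<sigma> * \<sigma> = 3"
    by (simp add: \<sigma>_def numeral_fps_const)
  have [simp]: "fps_deriv \<sigma> = 0" "fps_deriv X = 1" by (simp_all add: \<sigma>_def X_def)
  have S': "fps_deriv S = \<sigma> * C" and C': "fps_deriv C = - \<sigma> * S"
    by (simp_all add: S_def C_def \<sigma>_def fps_sin_deriv fps_cos_deriv flip: fps_const_neg)
  have SC: "S\<^sup>2 + C\<^sup>2 = 1" unfolding S_def C_def by (simp add: fps_sin_cos_sum_of_squares add.commute)
  \<comment> \<open>The double angle formula turns the tangent expression for \<open>B\<close> into
    a fraction in \<open>S\<close> and \<open>C\<close>, which yields \<open>T\<close> as
    \<open>P\<close> over \<open>D\<close>.\<close>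
  define D where "D = \<sigma> * S - C - 2"
  define P where "P = 1 - \<sigma> * S - C"
  have D': "fps_deriv D = 3 * C + \<sigma> * S"
    using \<sigma> by (simp add: D_def S' C' flip: mult.assoc)
  have P': "fps_deriv P = - 3 * C + \<sigma> * S"
    using \<sigma> by (simp add: P_def S' C' flip: mult.assoc)
  have [simp]: "fps_nth S 0 = 0" "fps_nth C 0 = 1" by (simp_all add: S_def C_def)
  have D0: "fps_nth D 0 = -3" by (simp add: D_def fps_numeral_nth_0)
  then have inv: "D * inverse D = 1"
    by (metis inverse_mult_eq_1' neg_equal_0_iff_equal zero_neq_numeral)

  have DT: "D * T = P"
  proof -
    define V where "V = D * T - P"
    \<comment> \<open>By \<open>eq1\<close> below, the left side is
      \<open>D\<^sup>2 + D * P + P\<^sup>2\<close> minus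
      \<open>D * fps_deriv P - P * fps_deriv D\<close>. Its vanishing is the Riccati equation for
      the quotient of \<open>P\<close> by \<open>D\<close>, cleared of denominators.\<close>
    have "D * (C - 1 - \<sigma> * S) + (1 + 2 * C) * P = 3 * (1 - (S\<^sup>2 + C\<^sup>2)) + (3 - \<sigma> * \<sigma>) * S\<^sup>2"
      unfolding D_def P_def by (simp add: algebra_simps power2_eq_square)
    then have eq0: "D * (C - 1 - \<sigma> * S) + (1 + 2 * C) * P = 0"
      by (simp add: \<sigma> SC)
    have eq1: "D + P - fps_deriv P = C - 1 - \<sigma> * S" "fps_deriv D + P = 1 + 2 * C"
      unfolding D' P' by (simp_all add: D_def P_def)
    \<comment> \<open>The difference of two Riccati solutions obeys a linear homogeneous equation,
      with \<open>T\<close> absorbed into the coefficient. The two remaining terms vanish by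
      \<open>eq1\<close> and \<open>eq0\<close>.\<close>
    have "D * fps_deriv V = (D + D * T + 1 + 2 * C) * V + D * T * (fps_deriv D + P - (1 + 2 * C)) +
        (D * (D + P - fps_deriv P) + (1 + 2 * C) * P)"
      by (simp add: V_def T' algebra_simps power2_eq_square)
    then have "D * fps_deriv V = (D + D * T + 1 + 2 * C) * V"
      by (simp add: eq1 eq0)
    then have "fps_deriv V = (inverse D * (D + D * T + 1 + 2 * C)) * V"
      using inv by (metis mult.assoc mult.commute mult.left_neutral)
    moreover have "fps_nth V 0 = 0" by (simp add: V_def T0 P_def)
    ultimately have "V = 0" by (rule fps_linear_ode_zero)
    then show ?thesis by (simp add: V_def)
  qed

  \<comment> \<open>An antiderivative of \<open>9 * (- X * fps_deriv D - X\<^sup>2 * D)\<close>; the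
    constant 15 makes it vanish at 0, as \<open>B1\<close> does.\<close>
  define N where "N = 6 * X ^ 3 + \<sigma> * (3 * X ^ 2 - 15 * X - 5) * S + 3 * (3 * X ^ 2 + 5 * X - 5) * C + 15"
  have N: "9 * D * B1 = N"
  proof -
    define V where "V = 9 * D * B1 - N"
    have "fps_deriv V = 9 * (D * fps_deriv B1 + fps_deriv D * B1) - fps_deriv N"
      by (simp add: V_def algebra_simps)
    also have "D * fps_deriv B1 + fps_deriv D * B1 = - X * fps_deriv D - X\<^sup>2 * D"
    proof -
      have "2 * P + D + fps_deriv D = 0" unfolding D' by (simp add: D_def P_def)
      \<comment> \<open>The forcing term is \<open>X * (2 * T + 1) - X\<^sup>2\<close>, so the
        factor \<open>2 * T + 1\<close> of \<open>B1\<close> occurs there too and both are cancelled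
        at once.\<close>
      moreover have "D * fps_deriv B1 + fps_deriv D * B1 =
          (2 * (D * T) + D + fps_deriv D) * (B1 + X) - X * fps_deriv D - X\<^sup>2 * D"
        unfolding ode X_def[symmetric] by (simp add: algebra_simps power2_eq_square)
      ultimately show ?thesis by (simp add: DT)
    qed
    also have "fps_deriv N = 9 * (- X * fps_deriv D - X\<^sup>2 * D)"
    proof -
      have "fps_deriv N = 18 * X\<^sup>2 + \<sigma> * (6 * X - 15) * S + (\<sigma> * \<sigma>) * (3 * X ^ 2 - 15 * X - 5) * C +
          3 * (6 * X + 5) * C + 3 * (3 * X ^ 2 + 5 * X - 5) * (- \<sigma> * S)"
        by (simp add: N_def S' C' fps_deriv_power power2_eq_square power3_eq_cube algebra_simps)
      then show ?thesis unfolding D' \<sigma> unfolding D_def by (simp add: algebra_simps power2_eq_square)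
    qed
    \<comment> \<open>A vanishing derivative is the case \<open>K = 0\<close> of
      \<open>fps_linear_ode_zero\<close>.\<close>
    finally have "fps_deriv V = 0 * V" by simp
    moreover have "fps_nth V 0 = 0"
      by (simp add: V_def N_def B10 X_def fps_numeral_nth_0)
    ultimately have "V = 0" by (rule fps_linear_ode_zero)
    then show ?thesis by (simp add: V_def)
  qed
  \<comment> \<open>The constant term is -27. Being nonzero, it lets the expansion of the complex
    function be computed as a quotient of power series.\<close>
  have nz: "fps_nth (9 * D) 0 \<noteq> 0" using D0 by (simp add: fps_numeral_nth_0)
  then have "9 * D \<noteq> 0" by auto
  then have "B1 = N / (9 * D)"
    using N by (metis nonzero_mult_div_cancel_left)
  moreover have "(\<lambda>z. (6 * z ^ 3 + s * (3 * z ^ 2 - 15 * z - 5) * sin (s * z)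
                + 3 * (3 * z ^ 2 + 5 * z - 5) * cos (s * z) + 15)
              / (9 * (s * sin (s * z) - cos (s * z) - 2))) has_fps_expansion N / (9 * D)"
    unfolding N_def D_def X_def \<sigma>_def S_def C_def
    by (intro fps_expansion_intros) (rule nz[unfolded D_def \<sigma>_def S_def C_def])
  ultimately show ?thesis using ode B10 B by simp
qed

end
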